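(* For any $q\in(0,1)$ and any sequence $\{X_n\}_{n\ge0}$ of i.i.d. (finite-valued) real random variables, the discrete-time Markov chain $\{W^R_n\}_{n\ge0}$ on $\mathbb{R}_+=[0,\infty)$ defined by $$W^R_{n+1}=Z_{n+1}\,(W^R_n+X_n)^+,\qquad n\ge0,$$ is Harris ergodic, where $\{Z_n\}_{n\ge1}$ are i.i.d. Bernoulli random variables with $\mathbb{P}(Z_n=0)=q=1-\mathbb{P}(Z_n=1)$.
   Context: $Y^+=\max(0,Y)$. The initial value $W^R_0\ge0$, the sequence $\{X_n\}$ and the sequence $\{Z_n\}$ are independent. Harris ergodic means positive Harris recurrent and aperiodic. The chain models the waiting times in a first-come first-served GI/GI/1 queue in which, independently at each arrival, the waiting time is reset to $0$ with probability $q$. *)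

theory Defs
  imports "HOL-Probability.Probability"
begin

section \<open>Markov kernels and the canonical chain\<close>

definition markov_kernel :: "'s measure \<Rightarrow> ('s \<Rightarrow> 's measure) \<Rightarrow> bool" where
  "markov_kernel S K \<longleftrightarrow> K \<in> measurable S (prob_algebra S)"

text \<open>The conditional law of the state at time \<open>n\<close> given the states \<open>h 0, \<dots>, h (n - 1)\<close>,
  for the chain with kernel \<open>K\<close> started at \<open>x\<close>.\<close>

fun chain_step :: "'s measure \<Rightarrow> ('s \<Rightarrow> 's measure) \<Rightarrow> 's \<Rightarrow> nat \<Rightarrow> (nat \<Rightarrow> 's) \<Rightarrow> 's measure" where
  "chain_step S K x 0 h = return S x"
| "chain_step S K x (Suc n) h = K (h n)"

text \<open>The law \<open>P\<^sub>x\<close> on the sequence space \<open>PiM UNIV (\<lambda>_. S)\<close> of the chain with kernel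
  \<open>K\<close> started at \<open>x\<close>: the projective limit given by the Ionescu-Tulcea theorem.\<close>

definition path_law :: "'s measure \<Rightarrow> ('s \<Rightarrow> 's measure) \<Rightarrow> 's \<Rightarrow> (nat \<Rightarrow> 's) measure" where
  "path_law S K x =
     projective_family.lim UNIV (Ionescu_Tulcea.CI (chain_step S K x) (\<lambda>_. S)) (\<lambda>_. S)"

lemma Ionescu_Tulcea_chain_step:
  assumes K: "markov_kernel S K" and x: "x \<in> space S"
  shows "Ionescu_Tulcea (chain_step S K x) (\<lambda>_. S)"
proof (rule Ionescu_Tulcea.intro)
  have Kp [measurable]: "K \<in> measurable S (prob_algebra S)"
    using K by (simp add: markov_kernel_def)
  fix i :: nat
  show "chain_step S K x i \<in> measurable (PiM {0..<i} (\<lambda>_. S)) (subprob_algebra S)"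
  proof (cases i)
    case 0
    have "return S x \<in> space (subprob_algebra S)"
      using x by (simp add: space_subprob_algebra prob_space_return prob_space_imp_subprob_space)
    moreover have "chain_step S K x i = (\<lambda>_. return S x)" using 0 by auto
    ultimately show ?thesis by simp
  next
    case (Suc n)
    have "(\<lambda>h. h n) \<in> measurable (PiM {0..<Suc n} (\<lambda>_. S)) S"
      by (rule measurable_component_singleton) simp
    then have "(\<lambda>h. K (h n)) \<in> measurable (PiM {0..<Suc n} (\<lambda>_. S)) (subprob_algebra S)"
      by (rule measurable_compose) (rule measurable_prob_algebraD[OF Kp])
    moreover have "chain_step S K x i = (\<lambda>h. K (h n))" using Suc by auto
    ultimately show ?thesis using Suc by simp
  qed
next
  fix i :: nat and h assume h: "h \<in> space (PiM {0..<i} (\<lambda>_. S))"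
  show "prob_space (chain_step S K x i h)"
  proof (cases i)
    case 0
    then show ?thesis using x by (simp add: prob_space_return)
  next
    case (Suc n)
    then have "h n \<in> space S" using h by (auto simp: space_PiM PiE_iff)
    then have "K (h n) \<in> space (prob_algebra S)"
      using K unfolding markov_kernel_def by (rule measurable_space[rotated])
    then show ?thesis using Suc by (simp add: space_prob_algebra)
  qed
qed

section \<open>Harris ergodicity\<close>

text \<open>Irreducibility measures, maximality, and cycles as in Meyn and Tweedie,
  \<^emph>\<open>Markov Chains and Stochastic Stability\<close>. Harris recurrence asks that sets charged by a
  maximal irreducibility measure be visited infinitely often from every initial state; the
  variant asking this only of initial states in the set itself is implied by it.\<close>

definition irreducibility_measure :: "'s measure \<Rightarrow> ('s \<Rightarrow> 's measure) \<Rightarrow> 's measure \<Rightarrow> bool" where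
  "irreducibility_measure S K \<phi> \<longleftrightarrow>
     sets \<phi> = sets S \<and> sigma_finite_measure \<phi> \<and> emeasure \<phi> (space S) > 0 \<and>
     (\<forall>x\<in>space S. \<forall>A\<in>sets S. emeasure \<phi> A > 0 \<longrightarrow>
        emeasure (path_law S K x) {\<omega> \<in> space (path_law S K x). \<exists>n\<ge>1. \<omega> n \<in> A} > 0)"

definition maximal_irreducibility_measure ::
    "'s measure \<Rightarrow> ('s \<Rightarrow> 's measure) \<Rightarrow> 's measure \<Rightarrow> bool" where
  "maximal_irreducibility_measure S K \<psi> \<longleftrightarrow>
     irreducibility_measure S K \<psi> \<and>
     (\<forall>\<phi>. irreducibility_measure S K \<phi> \<longrightarrow> absolutely_continuous \<psi> \<phi>)"

definition harris_recurrent :: "'s measure \<Rightarrow> ('s \<Rightarrow> 's measure) \<Rightarrow> bool" where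
  "harris_recurrent S K \<longleftrightarrow>
     (\<exists>\<psi>. maximal_irreducibility_measure S K \<psi> \<and>
        (\<forall>A\<in>sets S. emeasure \<psi> A > 0 \<longrightarrow>
           (\<forall>x\<in>space S. AE \<omega> in path_law S K x. \<exists>\<^sub>\<infinity>n. \<omega> n \<in> A)))"

definition positive_harris_recurrent :: "'s measure \<Rightarrow> ('s \<Rightarrow> 's measure) \<Rightarrow> bool" where
  "positive_harris_recurrent S K \<longleftrightarrow>
     harris_recurrent S K \<and> (\<exists>\<pi>\<in>space (prob_algebra S). \<pi> \<bind> K = \<pi>)"

definition is_cycle ::
    "'s measure \<Rightarrow> ('s \<Rightarrow> 's measure) \<Rightarrow> 's measure \<Rightarrow> nat \<Rightarrow> (nat \<Rightarrow> 's set) \<Rightarrow> bool" where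
  "is_cycle S K \<psi> d D \<longleftrightarrow>
     d \<ge> 1 \<and> (\<forall>i<d. D i \<in> sets S) \<and> disjoint_family_on D {..<d} \<and>
     (\<forall>i<d. \<forall>x\<in>D i. emeasure (K x) (D (Suc i mod d)) = 1) \<and>
     emeasure \<psi> (space S - (\<Union>i<d. D i)) = 0"

text \<open>The choice of \<open>\<psi>\<close> is immaterial, since any two maximal irreducibility measures have
  the same null sets.\<close>

definition aperiodic :: "'s measure \<Rightarrow> ('s \<Rightarrow> 's measure) \<Rightarrow> bool" where
  "aperiodic S K \<longleftrightarrow>
     (\<exists>\<psi>. maximal_irreducibility_measure S K \<psi> \<and> (\<forall>d D. is_cycle S K \<psi> d D \<longrightarrow> d = 1))"

definition harris_ergodic :: "'s measure \<Rightarrow> ('s \<Rightarrow> 's measure) \<Rightarrow> bool" where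
  "harris_ergodic S K \<longleftrightarrow> markov_kernel S K \<and> positive_harris_recurrent S K \<and> aperiodic S K"

section \<open>Processes that are Markov chains\<close>

definition history :: "'a measure \<Rightarrow> 's measure \<Rightarrow> (nat \<Rightarrow> 'a \<Rightarrow> 's) \<Rightarrow> nat \<Rightarrow> 'a measure" where
  "history M S W n =
     vimage_algebra (space M) (\<lambda>\<omega>. \<lambda>i\<in>{..n}. W i \<omega>) (PiM {..n} (\<lambda>_. S))"

definition markov_chain ::
    "'a measure \<Rightarrow> 's measure \<Rightarrow> ('s \<Rightarrow> 's measure) \<Rightarrow> (nat \<Rightarrow> 'a \<Rightarrow> 's) \<Rightarrow> bool" where
  "markov_chain M S K W \<longleftrightarrow>
     markov_kernel S K \<and> (\<forall>n. W n \<in> measurable M S) \<and>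
     (\<forall>n. \<forall>A\<in>sets S. AE \<omega> in M.
        real_cond_exp M (history M S W n) (\<lambda>\<omega>. indicator A (W (Suc n) \<omega>)) \<omega>
          = measure (K (W n \<omega>)) A)"

section \<open>The queue with resets\<close>

abbreviation nonneg_reals :: "real measure" where
  "nonneg_reals \<equiv> restrict_space borel {0..}"

text \<open>Mutual independence of the random variable \<open>W0\<close> and of the two sequences
  \<open>X\<^sub>0, X\<^sub>1, \<dots>\<close> and \<open>Z\<^sub>1, Z\<^sub>2, \<dots>\<close>, as independence of the three generated
  sigma-algebras. It says nothing about dependence within a sequence.\<close>

definition indep_initial_sequences ::
    "'a measure \<Rightarrow> ('a \<Rightarrow> real) \<Rightarrow> (nat \<Rightarrow> 'a \<Rightarrow> real) \<Rightarrow> (nat \<Rightarrow> 'a \<Rightarrow> real) \<Rightarrow> bool" where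
  "indep_initial_sequences M W0 X Z \<longleftrightarrow>
     prob_space.indep_sets M
       (\<lambda>i. sets
         ([vimage_algebra (space M) W0 borel,
           vimage_algebra (space M) (\<lambda>\<omega> n. X n \<omega>) (PiM UNIV (\<lambda>_. borel)),
           vimage_algebra (space M) (\<lambda>\<omega>. \<lambda>n\<in>{1..}. Z n \<omega>) (PiM {1..} (\<lambda>_. borel))] ! i))
       {..<3}"

text \<open>The law of one step \<open>Z (x + X)\<^sup>+\<close> from the state \<open>x\<close>.\<close>

definition reset_kernel ::
    "'a measure \<Rightarrow> ('a \<Rightarrow> real) \<Rightarrow> ('a \<Rightarrow> real) \<Rightarrow> real \<Rightarrow> real measure" where
  "reset_kernel M X Z x = distr M nonneg_reals (\<lambda>\<omega>. Z \<omega> * max 0 (x + X \<omega>))"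

end

theory Submission
  imports Defs
begin

text \<open>From every state the chain jumps to \<open>0\<close> with probability \<open>q\<close>, and otherwise it makes a step of
  the waiting-time recursion without resets. Counting back to the last reset, whose age is
  geometric, shows that the law of the unreset walk from \<open>0\<close>, stopped at an independent geometric
  time, is stationary. A set charged by this law is charged by the walk from \<open>0\<close> at some fixed time
  \<open>n\<close>, so from every state it is reached after \<open>n + 1\<close> steps with probability bounded away from zero,
  and hence it is visited infinitely often. The atom \<open>0\<close> is reached in one step from
  everywhere, which excludes cycles of length greater than one.\<close>

section \<open>The path law\<close>

text \<open>The reset makes the whole state space a small set: from every state,
  \<open>kernel_op K g\<close> is at least q times the value of \<open>g\<close> at the atom. Lower
  bounds proved from the atom therefore hold uniformly, whatever the drift of the increments. The
  stationary law itself serves as the maximal irreducibility measure. It charges the atom, so by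
  invariance a null set of it has transition probability zero from the atom at every time. The chain
  started there almost surely avoids such a set, and no irreducibility measure can charge it.
  Statements about paths are reduced to iterates of the kernel on nonnegative functions by a Markov
  property at deterministic times. For the process \<open>W\<close> the obstacle is that
  independence is given separately within and between the sequences. Both are merged into one
  independent family over a sum type, in which W_0, ..., W_n and the pair X_n, Z_{n+1} read disjoint
  blocks of indices.\<close>

lemma sets_path_law:
  assumes "markov_kernel S K" "x \<in> space S"
  shows "sets (path_law S K x) = sets (PiM UNIV (\<lambda>_. S))"
proof -
  interpret Ionescu_Tulcea "chain_step S K x" "\<lambda>_. S"
    by (rule Ionescu_Tulcea_chain_step[OF assms])
  show ?thesis
    by (simp add: path_law_def)
qed

lemma space_path_law:
  assumes "markov_kernel S K" "x \<in> space S"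
  shows "space (path_law S K x) = space (PiM UNIV (\<lambda>_. S))"
  by (rule sets_eq_imp_space_eq) (rule sets_path_law[OF assms])

lemma prob_space_path_law:
  assumes "markov_kernel S K" "x \<in> space S"
  shows "prob_space (path_law S K x)"
proof -
  interpret Ionescu_Tulcea "chain_step S K x" "\<lambda>_. S"
    by (rule Ionescu_Tulcea_chain_step[OF assms])
  \<comment> \<open>An image measure has the same total mass, so the marginal on the empty index set
    already decides the claim.\<close>
  have "prob_space (distr (path_law S K x) (PiM {} (\<lambda>_. S)) (\<lambda>\<omega>. restrict \<omega> {}))"
    using distr_lim[of "{}"] PF.prob_space_P[of "{}"] by (simp add: path_law_def)
  moreover have "(\<lambda>\<omega>. restrict \<omega> {}) \<in> measurable (path_law S K x) (PiM {} (\<lambda>_. S))"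
    unfolding measurable_cong_sets[OF sets_path_law[OF assms] refl] by (rule measurable_restrict_subset) simp
  ultimately show ?thesis
    using prob_space_distrD by blast
qed

section \<open>Finite-dimensional marginals and the Markov property of the path law\<close>

lemma nn_integral_path_law_marginal:
  fixes h :: "(nat \<Rightarrow> 'a) \<Rightarrow> ennreal"
  assumes K: "markov_kernel S K" and x: "x \<in> space S"
    and h: "h \<in> borel_measurable (PiM {0..<m} (\<lambda>_. S))"
  shows "(\<integral>\<^sup>+\<omega>. h (restrict \<omega> {0..<m}) \<partial>path_law S K x) =
    (\<integral>\<^sup>+\<omega>. h \<omega> \<partial>Ionescu_Tulcea.C (chain_step S K x) (\<lambda>_. S) 0 m (\<lambda>_. undefined))"
proof -
  interpret IT: Ionescu_Tulcea "chain_step S K x" "\<lambda>_. S"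
    by (rule Ionescu_Tulcea_chain_step[OF K x])
  have r: "(\<lambda>\<omega>. restrict \<omega> {0..<m}) \<in> measurable (path_law S K x) (PiM {0..<m} (\<lambda>_. S))"
    unfolding measurable_cong_sets[OF sets_path_law[OF K x] refl] by (rule measurable_restrict_subset) simp
  \<comment> \<open>\<open>CI J\<close> is \<open>C 0 (up_to J)\<close> projected to
    \<open>J\<close>. Here the projection keeps all coordinates, so \<open>CI {0..<m}\<close> is
    \<open>C 0 m\<close> itself.\<close>
  have up: "IT.up_to {0..<m} = m"
    by (intro antisym) (auto simp: IT.up_to_iff not_le[symmetric] intro: IT.up_to_less ccontr
        dest: IT.up_to_less[of "{0..<m}" "IT.up_to {0..<m}", simplified])
  have "(\<integral>\<^sup>+\<omega>. h (restrict \<omega> {0..<m}) \<partial>path_law S K x)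
    = (\<integral>\<^sup>+\<omega>. h \<omega> \<partial>distr (path_law S K x) (PiM {0..<m} (\<lambda>_. S)) (\<lambda>\<omega>. restrict \<omega> {0..<m}))"
    using h by (subst nn_integral_distr[OF r]) auto
  also have "distr (path_law S K x) (PiM {0..<m} (\<lambda>_. S)) (\<lambda>\<omega>. restrict \<omega> {0..<m}) = IT.CI {0..<m}"
    unfolding path_law_def by (rule IT.distr_lim) simp
  also have "\<dots> = IT.C 0 m (\<lambda>_. undefined)"
    unfolding IT.CI_def up using IT.distr_C[of m m "\<lambda>_. undefined" 0] by (simp add: space_PiM)
  finally show ?thesis .
qed

text \<open>The one-step Markov property. The Ionescu-Tulcea construction extends a history with
  coordinates 0 to n by one coordinate with law \<open>K (\<omega> n)\<close>, and \<open>f\<close>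
  does not see the new coordinate.\<close>

lemma nn_integral_path_law_Suc:
  assumes K: "markov_kernel S K" and x: "x \<in> space S"
    and f [measurable]: "f \<in> borel_measurable (PiM {0..<Suc n} (\<lambda>_. S))"
    and g [measurable]: "g \<in> borel_measurable S"
  shows "(\<integral>\<^sup>+\<omega>. f (restrict \<omega> {0..<Suc n}) * g (\<omega> (Suc n)) \<partial>path_law S K x) =
    (\<integral>\<^sup>+\<omega>. f (restrict \<omega> {0..<Suc n}) * (\<integral>\<^sup>+y. g y \<partial>K (\<omega> n)) \<partial>path_law S K x)"
proof -
  interpret IT: Ionescu_Tulcea "chain_step S K x" "\<lambda>_. S"
    by (rule Ionescu_Tulcea_chain_step[OF K x])
  have Kp: "K \<in> measurable S (subprob_algebra S)"
    using K unfolding markov_kernel_def by (rule measurable_prob_algebraD)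
  note marginal = nn_integral_path_law_marginal[OF K x]
  have [measurable]: "(\<lambda>\<omega>. restrict \<omega> {0..<Suc n}) \<in> measurable (PiM {0..<Suc (Suc n)} (\<lambda>_. S)) (PiM {0..<Suc n} (\<lambda>_. S))"
    by (rule measurable_restrict_subset) auto
  have gK: "(\<lambda>y. \<integral>\<^sup>+z. g z \<partial>K y) \<in> borel_measurable S"
    using nn_integral_measurable_subprob_algebra2[of "\<lambda>x y. g y" S S K] Kp by simp
  have comp: "(\<lambda>\<omega>. \<omega> n) \<in> measurable (PiM {0..<Suc n} (\<lambda>_. S)) S"
    "(\<lambda>\<omega>. \<omega> (Suc n)) \<in> measurable (PiM {0..<Suc (Suc n)} (\<lambda>_. S)) S"
    by (auto intro: measurable_component_singleton)
  define h where "h = (\<lambda>\<omega>. f (restrict \<omega> {0..<Suc n}) * g (\<omega> (Suc n)))"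
  have h [measurable]: "h \<in> borel_measurable (PiM {0..<Suc (Suc n)} (\<lambda>_. S))"
    unfolding h_def using measurable_compose[OF comp(2) g] by measurable
  have "(\<integral>\<^sup>+\<omega>. f (restrict \<omega> {0..<Suc n}) * g (\<omega> (Suc n)) \<partial>path_law S K x)
    = (\<integral>\<^sup>+\<omega>. h (restrict \<omega> {0..<Suc (Suc n)}) \<partial>path_law S K x)"
    by (intro nn_integral_cong) (simp add: h_def Int_absorb1 Int_absorb2)
  also have "\<dots> = (\<integral>\<^sup>+\<omega>. \<integral>\<^sup>+\<omega>'. h \<omega>' \<partial>IT.eP (Suc n) \<omega> \<partial>IT.C 0 (Suc n) (\<lambda>_. undefined))"
    unfolding marginal[OF h]
    using IT.measurable_eP[of "Suc n"]
    by (subst IT.C.simps(2), subst nn_integral_bind[where B="PiM {0..<Suc (Suc n)} (\<lambda>_. S)"])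
       (auto simp: measurable_cong_sets[OF IT.sets_C] space_PiM simp del: IT.C.simps)
  also have "\<dots> = (\<integral>\<^sup>+\<omega>. f \<omega> * (\<integral>\<^sup>+y. g y \<partial>K (\<omega> n)) \<partial>IT.C 0 (Suc n) (\<lambda>_. undefined))"
  proof (intro nn_integral_cong)
    fix \<omega> assume "\<omega> \<in> space (IT.C 0 (Suc n) (\<lambda>_. undefined))"
    then have \<omega>: "\<omega> \<in> space (PiM {0..<Suc n} (\<lambda>_. S))"
      by (simp add: IT.space_C space_PiM del: IT.C.simps)
    \<comment> \<open>The new coordinate \<open>Suc n\<close> lies outside
      \<open>{0..<Suc n}\<close>, so the factor \<open>f\<close> is constant in the inner
      integral.\<close>
    have res: "restrict (fun_upd \<omega> (Suc n) y) {0..<Suc n} = \<omega>" for y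
      using \<omega> by (auto simp: space_PiM PiE_iff extensional_def restrict_def)
    have "\<omega> n \<in> space S" using \<omega> by (auto simp: space_PiM PiE_iff)
    then have "sets (K (\<omega> n)) = sets S" using Kp by (simp add: sets_kernel)
    then have "g \<in> borel_measurable (K (\<omega> n))" by (simp cong: measurable_cong_sets)
    then show "(\<integral>\<^sup>+\<omega>'. h \<omega>' \<partial>IT.eP (Suc n) \<omega>) = f \<omega> * (\<integral>\<^sup>+y. g y \<partial>K (\<omega> n))"
      by (subst IT.nn_integral_eP[OF \<omega> h]) (simp add: h_def res nn_integral_cmult del: restrict_apply)
  qed
  also have "\<dots> = (\<integral>\<^sup>+\<omega>. f (restrict \<omega> {0..<Suc n}) * (\<integral>\<^sup>+y. g y \<partial>K (restrict \<omega> {0..<Suc n} n)) \<partial>path_law S K x)"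
    using measurable_compose[OF comp(1) gK] by (subst marginal[symmetric]) auto
  finally show ?thesis by simp
qed

text \<open>The start counts as a step with law \<open>return S x\<close>: coordinate 0 arises from
  one extension of the empty history.\<close>

lemma nn_integral_path_law_0:
  assumes K: "markov_kernel S K" and x: "x \<in> space S"
    and g [measurable]: "g \<in> borel_measurable S"
  shows "(\<integral>\<^sup>+\<omega>. g (\<omega> 0) \<partial>path_law S K x) = g x"
proof -
  interpret IT: Ionescu_Tulcea "chain_step S K x" "\<lambda>_. S"
    by (rule Ionescu_Tulcea_chain_step[OF K x])
  have m: "(\<lambda>\<omega>. g (\<omega> 0)) \<in> borel_measurable (PiM {0..<Suc 0} (\<lambda>_. S))"
    using g by (rule measurable_compose[rotated]) (rule measurable_component_singleton, simp)
  have u: "(\<lambda>_. undefined) \<in> space (PiM {0..<0::nat} (\<lambda>_. S))"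
    by (simp add: space_PiM)
  have "(\<integral>\<^sup>+\<omega>. g (\<omega> 0) \<partial>path_law S K x) = (\<integral>\<^sup>+\<omega>. g (\<omega> 0) \<partial>IT.C 0 (Suc 0) (\<lambda>_. undefined))"
    using nn_integral_path_law_marginal[OF K x m] by simp
  also have "\<dots> = (\<integral>\<^sup>+\<omega>. g (\<omega> 0) \<partial>IT.eP 0 (\<lambda>_. undefined))"
    by (simp only: IT.C.simps add_0 bind_return[OF IT.measurable_eP u])
  also have "\<dots> = g x"
    using x by (subst IT.nn_integral_eP[OF u m]) (simp add: nn_integral_return)
  finally show ?thesis .
qed

text \<open>The kernel acting on nonnegative functions. Iterates applied to
  \<open>indicator A\<close> are the n-step transition probabilities into \<open>A\<close>, so no
  powers of the kernel as measures are needed.\<close>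

definition kernel_op :: "('s \<Rightarrow> 's measure) \<Rightarrow> ('s \<Rightarrow> ennreal) \<Rightarrow> 's \<Rightarrow> ennreal" where
  "kernel_op K g x = (\<integral>\<^sup>+y. g y \<partial>K x)"

lemma measurable_kernel_op:
  assumes "markov_kernel S K" "g \<in> borel_measurable S"
  shows "kernel_op K g \<in> borel_measurable S"
proof -
  have [measurable]: "K \<in> measurable S (subprob_algebra S)"
    using assms(1) unfolding markov_kernel_def by (rule measurable_prob_algebraD)
  note [measurable] = assms(2)
  show ?thesis
    unfolding kernel_op_def[abs_def]
    by (rule nn_integral_measurable_subprob_algebra2[where N=S]) measurable
qed

lemma measurable_kernel_op_funpow:
  assumes "markov_kernel S K" "g \<in> borel_measurable S"
  shows "(kernel_op K ^^ n) g \<in> borel_measurable S"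
  using assms by (induction n) (auto intro: measurable_kernel_op)

text \<open>The Markov property at lag \<open>k\<close>: peeling off the last step replaces
  \<open>g\<close> by \<open>kernel_op K g\<close> one time unit earlier, hence the induction over
  all \<open>g\<close>.\<close>

lemma nn_integral_path_law_add:
  assumes K: "markov_kernel S K" and x: "x \<in> space S"
    and f: "f \<in> borel_measurable (PiM {0..<Suc n} (\<lambda>_. S))"
    and g: "g \<in> borel_measurable S"
  shows "(\<integral>\<^sup>+\<omega>. f (restrict \<omega> {0..<Suc n}) * g (\<omega> (n + k)) \<partial>path_law S K x) =
    (\<integral>\<^sup>+\<omega>. f (restrict \<omega> {0..<Suc n}) * (kernel_op K ^^ k) g (\<omega> n) \<partial>path_law S K x)"
  using g
proof (induction k arbitrary: g)
  case (Suc k)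
  \<comment> \<open>\<open>f\<close> reads only times up to n, so it may be regarded as a function
    of the longer history up to n + k.\<close>
  have m: "(\<lambda>\<omega>. f (restrict \<omega> {0..<Suc n})) \<in> borel_measurable (PiM {0..<Suc (n + k)} (\<lambda>_. S))"
    by (rule measurable_compose[OF measurable_restrict_subset f]) auto
  have "{0..<Suc (n + k)} \<inter> {0..<Suc n} = {0..<Suc n}" by auto
  then have "(\<integral>\<^sup>+\<omega>. f (restrict \<omega> {0..<Suc n}) * g (\<omega> (n + Suc k)) \<partial>path_law S K x) =
    (\<integral>\<^sup>+\<omega>. f (restrict \<omega> {0..<Suc n}) * kernel_op K g (\<omega> (n + k)) \<partial>path_law S K x)"
    using nn_integral_path_law_Suc[OF K x m Suc.prems] by (simp add: kernel_op_def del: restrict_apply)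
  also have "\<dots> = (\<integral>\<^sup>+\<omega>. f (restrict \<omega> {0..<Suc n}) * (kernel_op K ^^ Suc k) g (\<omega> n) \<partial>path_law S K x)"
    using Suc.IH[OF measurable_kernel_op[OF K Suc.prems]]
    by (simp add: funpow_Suc_right del: funpow.simps restrict_apply)
  finally show ?case .
qed simp

lemma nn_integral_path_law_component:
  assumes K: "markov_kernel S K" and x: "x \<in> space S" and g: "g \<in> borel_measurable S"
  shows "(\<integral>\<^sup>+\<omega>. g (\<omega> n) \<partial>path_law S K x) = (kernel_op K ^^ n) g x"
  using nn_integral_path_law_add[OF K x, of "\<lambda>_. 1" 0 g n]
    nn_integral_path_law_0[OF K x measurable_kernel_op_funpow[OF K g]] g
  by simp

section \<open>Infinitely many visits from a uniform lower bound, and avoidance\<close>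

lemma measurable_path_law_component:
  assumes "markov_kernel S K" "x \<in> space S"
  shows "(\<lambda>\<omega>. \<omega> n) \<in> measurable (path_law S K x) S"
  unfolding measurable_cong_sets[OF sets_path_law[OF assms] refl]
  by (rule measurable_component_singleton) simp

text \<open>If the chain avoids \<open>A\<close> from time \<open>N\<close> on up to time \<open>n\<close>, it enters \<open>A\<close> at time \<open>n + k\<close> with
  probability at least \<open>\<epsilon>\<close>; so the limit \<open>e\<close> of the avoidance probabilities satisfies
  \<open>e + \<epsilon> e \<le> e\<close>.\<close>

lemma AE_path_law_infinitely_often:
  assumes K: "markov_kernel S K" and x: "x \<in> space S" and A: "A \<in> sets S"
    and \<epsilon>: "0 < \<epsilon>" "\<And>y. y \<in> space S \<Longrightarrow> ennreal \<epsilon> \<le> (kernel_op K ^^ k) (indicator A) y"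
  shows "AE \<omega> in path_law S K x. \<exists>\<^sub>\<infinity>n. \<omega> n \<in> A"
proof -
  let ?P = "path_law S K x"
  interpret P: prob_space ?P by (rule prob_space_path_law[OF K x])
  note comp [measurable] = measurable_path_law_component[OF K x]
  note A [measurable]
  have "AE \<omega> in ?P. \<exists>i\<ge>N. \<omega> i \<in> A" for N
  proof -
    define E where "E n = {\<omega> \<in> space ?P. \<forall>i\<in>{N..n}. \<omega> i \<notin> A}" for n
    have E [measurable]: "E n \<in> sets ?P" for n unfolding E_def by measurable
    have step: "P.prob (E (n + k)) + \<epsilon> * P.prob (E n) \<le> P.prob (E n)" if n: "N \<le> n" for n
    proof -
      \<comment> \<open>The event \<open>E n\<close> as a set of finite histories, the form that the
        Markov property accepts.\<close>
      define F where "F = {h \<in> space (PiM {0..<Suc n} (\<lambda>_. S)). \<forall>i\<in>{N..n}. h i \<notin> A}"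
      have [measurable]: "(\<lambda>h. h i) \<in> measurable (PiM {0..<Suc n} (\<lambda>_. S)) S" if "i \<in> {N..n}" for i
        using that by (intro measurable_component_singleton) simp
      have F [measurable]: "F \<in> sets (PiM {0..<Suc n} (\<lambda>_. S))" unfolding F_def by measurable
      have FE: "indicator F (restrict \<omega> {0..<Suc n}) = (indicator (E n) \<omega> :: ennreal)"
        if "\<omega> \<in> space ?P" for \<omega>
        using that by (auto simp: indicator_def F_def E_def space_path_law[OF K x] space_PiM PiE_iff)
      have "ennreal \<epsilon> * emeasure ?P (E n) = (\<integral>\<^sup>+\<omega>. ennreal \<epsilon> * indicator (E n) \<omega> \<partial>?P)"
        by (simp add: nn_integral_cmult_indicator)
      also have "\<dots> \<le> (\<integral>\<^sup>+\<omega>. indicator F (restrict \<omega> {0..<Suc n}) *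
          (kernel_op K ^^ k) (indicator A) (\<omega> n) \<partial>?P)"
        by (intro nn_integral_mono)
          (auto simp: FE mult.commute[of "ennreal \<epsilon>"] intro!: mult_left_mono \<epsilon>(2) measurable_space[OF comp])
      also have "\<dots> = (\<integral>\<^sup>+\<omega>. indicator F (restrict \<omega> {0..<Suc n}) * indicator A (\<omega> (n + k)) \<partial>?P)"
        by (rule nn_integral_path_law_add[OF K x, symmetric]) auto
      \<comment> \<open>On \<open>E n\<close>, a visit to \<open>A\<close> at time n + k excludes
        \<open>E (n + k)\<close>, because \<open>N \<le> n\<close> puts n + k among the times
        watched there.\<close>
      also have "\<dots> \<le> (\<integral>\<^sup>+\<omega>. indicator (E n - E (n + k)) \<omega> \<partial>?P)"
        using n by (intro nn_integral_mono, simp only: FE) (auto simp: indicator_def E_def)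
      also have "\<dots> = emeasure ?P (E n - E (n + k))"
        by simp
      finally have "\<epsilon> * P.prob (E n) \<le> P.prob (E n - E (n + k))"
        using \<epsilon>(1) by (simp add: P.emeasure_eq_measure flip: ennreal_mult)
      also have "\<dots> = P.prob (E n) - P.prob (E (n + k))"
        by (intro P.finite_measure_Diff) (auto simp: E_def)
      finally show ?thesis by simp
    qed
    \<comment> \<open>The events \<open>E n\<close> decrease to the event that \<open>A\<close> is
      not visited from time \<open>N\<close> on.\<close>
    have lim: "(\<lambda>n. P.prob (E n)) \<longlonglongrightarrow> P.prob (\<Inter>n. E n)"
      by (intro P.finite_Lim_measure_decseq) (auto simp: decseq_def E_def)
    have "(\<lambda>n. P.prob (E (n + k)) + \<epsilon> * P.prob (E n)) \<longlonglongrightarrow> P.prob (\<Inter>n. E n) + \<epsilon> * P.prob (\<Inter>n. E n)"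
      by (intro tendsto_add tendsto_mult_left lim LIMSEQ_ignore_initial_segment)
    then have "P.prob (\<Inter>n. E n) + \<epsilon> * P.prob (\<Inter>n. E n) \<le> P.prob (\<Inter>n. E n)"
      using step by (intro LIMSEQ_le[OF _ lim]) auto
    then have "P.prob (\<Inter>n. E n) = 0"
      using \<epsilon>(1) by (intro antisym) (simp_all add: mult_le_0_iff)
    then have "(\<Inter>n. E n) \<in> null_sets ?P"
      by (auto simp: null_sets_def P.emeasure_eq_measure)
    then show ?thesis
      by (rule AE_I') (auto simp: E_def)
  qed
  then show ?thesis
    by (simp add: INFM_nat_le AE_all_countable)
qed

text \<open>Each time contributes a null event and there are countably many times. This feeds the
  proof of maximality.\<close>

lemma AE_path_law_avoids:
  assumes K: "markov_kernel S K" and x: "x \<in> space S" and A: "A \<in> sets S"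
    and "\<And>n. (kernel_op K ^^ n) (indicator A) x = 0"
  shows "AE \<omega> in path_law S K x. \<forall>n. \<omega> n \<notin> A"
proof -
  note [measurable] = measurable_path_law_component[OF K x] A
  have "AE \<omega> in path_law S K x. \<omega> n \<notin> A" for n
  proof -
    have "(\<integral>\<^sup>+\<omega>. indicator A (\<omega> n) \<partial>path_law S K x) = 0"
      using nn_integral_path_law_component[OF K x, of "indicator A" n] A assms(4) by simp
    then have "AE \<omega> in path_law S K x. (indicator A (\<omega> n) :: ennreal) = 0"
      by (subst (asm) nn_integral_0_iff_AE) auto
    then show ?thesis by (auto simp: indicator_def)
  qed
  then show ?thesis by (simp add: AE_all_countable)
qed


section \<open>Chains with resets to an atom\<close>

text \<open>Conditioning on the first trial: the value is 0 with probability q, and otherwise 1 plus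
  a fresh geometric variable. This renewal identity will give stationarity.\<close>

lemma nn_integral_geometric_pmf_unfold:
  assumes "0 < q" "q \<le> 1"
  shows "(\<integral>\<^sup>+n. f n \<partial>geometric_pmf q) = ennreal q * f 0 + ennreal (1 - q) * (\<integral>\<^sup>+n. f (Suc n) \<partial>geometric_pmf q)"
  using assms
  by (subst geometric_bind_pmf_unfold) (auto simp: nn_integral_bind_pmf mult.commute)

text \<open>The outcome \<open>True\<close> of the coin is the reset. The dynamics between resets is
  an arbitrary kernel \<open>L\<close>, so stability comes from the resets alone.\<close>

locale resetting_chain =
  fixes S :: "'s measure" and K L :: "'s \<Rightarrow> 's measure" and a :: 's and q :: real
  assumes L: "markov_kernel S L"
    and a: "a \<in> space S" "{a} \<in> sets S"
    and q: "0 < q" "q < 1"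
    and K_eq: "\<And>x. x \<in> space S \<Longrightarrow> K x = measure_pmf (bernoulli_pmf q) \<bind> (\<lambda>b. if b then return S a else L x)"
begin

lemma L_measurable [measurable]: "L \<in> measurable S (prob_algebra S)"
  using L by (simp add: markov_kernel_def)

lemma reset_branch_measurable:
  assumes "x \<in> space S"
  shows "(\<lambda>b. if b then return S a else L x) \<in> measurable (measure_pmf p) (prob_algebra S)"
  using assms a measurable_space[OF L_measurable assms]
  by (auto simp: measurable_def space_prob_algebra prob_space_return)

lemma markov_kernel: "markov_kernel S K"
proof -
  have [measurable]: "a \<in> space S" by (rule a)
  have "measure_pmf (bernoulli_pmf q) \<in> space (prob_algebra (count_space UNIV))"
    by (simp add: space_prob_algebra measure_pmf.prob_space_axioms)
  then have "(\<lambda>x. measure_pmf (bernoulli_pmf q) \<bind> (\<lambda>b. if b then return S a else L x)) \<in> measurable S (prob_algebra S)"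
    by measurable
  then show ?thesis
    using K_eq by (simp add: markov_kernel_def cong: measurable_cong)
qed

lemma K_measurable [measurable]: "K \<in> measurable S (prob_algebra S)"
  using markov_kernel by (simp add: markov_kernel_def)

text \<open>As an equality this yields invariance; dropping one summand yields the two lower bounds
  behind recurrence, by a reset or by a reset-free step.\<close>

lemma kernel_op_K:
  assumes x: "x \<in> space S" and g: "g \<in> borel_measurable S"
  shows "kernel_op K g x = ennreal q * g a + ennreal (1 - q) * kernel_op L g x"
  using q g a unfolding kernel_op_def K_eq[OF x]
  by (subst nn_integral_bind[OF g measurable_prob_algebraD[OF reset_branch_measurable[OF x]]])
    (simp add: nn_integral_return mult.commute)

section \<open>The unreset walk from the atom and the stationary law\<close>

primrec walk :: "nat \<Rightarrow> 's measure" where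
  "walk 0 = return S a"
| "walk (Suc n) = walk n \<bind> L"

lemma walk_in_space: "walk n \<in> space (prob_algebra S)"
proof (induction n)
  case 0
  then show ?case using a by (simp add: space_prob_algebra prob_space_return)
next
  case (Suc n)
  then show ?case
    using prob_space_bind'[OF Suc L_measurable] sets_bind'[OF Suc L_measurable] by (simp add: space_prob_algebra)
qed

lemma walk_measurable [measurable]: "walk \<in> measurable (measure_pmf p) (prob_algebra S)"
  using walk_in_space by (auto simp: measurable_def space_prob_algebra)

lemma sets_walk [simp, measurable_cong]: "sets (walk n) = sets S"
  using walk_in_space by (simp add: space_prob_algebra)

lemma space_walk [simp]: "space (walk n) = space S"
  by (rule sets_eq_imp_space_eq) simp

lemma nn_integral_walk_Suc:
  assumes "g \<in> borel_measurable S"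
  shows "(\<integral>\<^sup>+y. g y \<partial>walk (Suc n)) = (\<integral>\<^sup>+y. kernel_op L g y \<partial>walk n)"
  using nn_integral_bind[OF assms, of L "walk n"]
  by (simp add: kernel_op_def measurable_prob_algebraD)

text \<open>Only paths with no reset in n steps are kept; this has probability (1 - q)^n, and on it
  the chain moves by \<open>L\<close>.\<close>

lemma walk_le_kernel_op:
  assumes "g \<in> borel_measurable S"
  shows "ennreal ((1 - q) ^ n) * (\<integral>\<^sup>+y. g y \<partial>walk n) \<le> (kernel_op K ^^ n) g a"
  using assms
proof (induction n arbitrary: g)
  case 0
  then show ?case using a by (simp add: nn_integral_return)
next
  case (Suc n)
  have "ennreal ((1 - q) ^ Suc n) * (\<integral>\<^sup>+y. g y \<partial>walk (Suc n))
    = ennreal ((1 - q) ^ n) * (\<integral>\<^sup>+y. ennreal (1 - q) * kernel_op L g y \<partial>walk n)"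
    using q measurable_kernel_op[OF L Suc.prems]
    by (simp only: nn_integral_walk_Suc[OF Suc.prems])
      (simp add: nn_integral_cmult ennreal_mult mult_ac)
  \<comment> \<open>The reset summand of \<open>kernel_op K g\<close> is dropped; the induction
    hypothesis is then used for \<open>kernel_op K g\<close> in place of \<open>g\<close>.\<close>
  also have "\<dots> \<le> ennreal ((1 - q) ^ n) * (\<integral>\<^sup>+y. kernel_op K g y \<partial>walk n)"
    by (intro mult_left_mono nn_integral_mono) (auto simp: kernel_op_K[OF _ Suc.prems])
  also have "\<dots> \<le> (kernel_op K ^^ n) (kernel_op K g) a"
    by (intro Suc.IH measurable_kernel_op[OF markov_kernel Suc.prems])
  finally show ?case by (simp add: funpow_swap1)
qed

text \<open>The number of steps since the last reset is geometric in equilibrium.\<close>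

definition stationary_law :: "'s measure" where
  "stationary_law = measure_pmf (geometric_pmf q) \<bind> walk"

lemma nn_integral_stationary_law:
  assumes "g \<in> borel_measurable S"
  shows "(\<integral>\<^sup>+y. g y \<partial>stationary_law) = (\<integral>\<^sup>+n. \<integral>\<^sup>+y. g y \<partial>walk n \<partial>geometric_pmf q)"
  unfolding stationary_law_def
  by (rule nn_integral_bind[OF assms measurable_prob_algebraD[OF walk_measurable]])

lemma stationary_law_in_space: "stationary_law \<in> space (prob_algebra S)"
proof -
  have "measure_pmf (geometric_pmf q) \<in> space (prob_algebra (measure_pmf (geometric_pmf q)))"
    by (simp add: space_prob_algebra measure_pmf.prob_space_axioms)
  from prob_space_bind'[OF this walk_measurable] sets_bind'[OF this walk_measurable] show ?thesis
    by (simp add: stationary_law_def space_prob_algebra)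
qed

lemma sets_stationary_law [simp, measurable_cong]: "sets stationary_law = sets S"
  using stationary_law_in_space by (simp add: space_prob_algebra)

lemma space_stationary_law [simp]: "space stationary_law = space S"
  by (rule sets_eq_imp_space_eq) simp

text \<open>A reset sets the age to 0, and a step of \<open>L\<close> turns \<open>walk n\<close>
  into \<open>walk (Suc n)\<close>. The result is exactly the first-trial unfolding of the geometric
  mixture.\<close>

lemma nn_integral_kernel_op_stationary_law:
  assumes g: "g \<in> borel_measurable S"
  shows "(\<integral>\<^sup>+y. kernel_op K g y \<partial>stationary_law) = (\<integral>\<^sup>+y. g y \<partial>stationary_law)"
proof -
  interpret prob_space stationary_law
    using stationary_law_in_space by (simp add: space_prob_algebra)
  have m: "kernel_op L g \<in> borel_measurable stationary_law"
    using measurable_kernel_op[OF L g] by simp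
  have "(\<integral>\<^sup>+y. kernel_op K g y \<partial>stationary_law) =
      (\<integral>\<^sup>+y. ennreal q * g a + ennreal (1 - q) * kernel_op L g y \<partial>stationary_law)"
    by (intro nn_integral_cong) (simp add: kernel_op_K[OF _ g])
  also have "\<dots> = ennreal q * g a + ennreal (1 - q) * (\<integral>\<^sup>+y. kernel_op L g y \<partial>stationary_law)"
    using m emeasure_space_1 by (simp add: nn_integral_add nn_integral_cmult)
  also have "(\<integral>\<^sup>+y. kernel_op L g y \<partial>stationary_law) = (\<integral>\<^sup>+n. \<integral>\<^sup>+y. g y \<partial>walk (Suc n) \<partial>geometric_pmf q)"
    by (simp only: nn_integral_stationary_law[OF measurable_kernel_op[OF L g]] nn_integral_walk_Suc[OF g])
  also have "g a = (\<integral>\<^sup>+y. g y \<partial>walk 0)"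
    using a g by (simp add: nn_integral_return)
  finally show ?thesis
    unfolding nn_integral_stationary_law[OF g]
    using nn_integral_geometric_pmf_unfold[of q "\<lambda>n. \<integral>\<^sup>+y. g y \<partial>walk n"] q by (simp del: walk.simps)
qed

lemma stationary_law_invariant: "stationary_law \<bind> K = stationary_law"
proof (rule measure_eqI)
  have ne: "space stationary_law \<noteq> {}" using a by auto
  have K': "K \<in> measurable stationary_law (subprob_algebra S)"
    by (simp add: measurable_prob_algebraD)
  show sets_eq: "sets (stationary_law \<bind> K) = sets stationary_law"
    using sets_bind_measurable[OF K' ne] by simp
  fix A assume "A \<in> sets (stationary_law \<bind> K)"
  then have A: "A \<in> sets S" using sets_eq by simp
  have "emeasure (stationary_law \<bind> K) A = (\<integral>\<^sup>+x. emeasure (K x) A \<partial>stationary_law)"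
    by (rule emeasure_bind[OF ne K' A])
  also have "\<dots> = (\<integral>\<^sup>+x. kernel_op K (indicator A) x \<partial>stationary_law)"
    using A sets_kernel[OF K'] by (intro nn_integral_cong) (simp add: kernel_op_def)
  also have "\<dots> = emeasure stationary_law A"
    using A by (simp add: nn_integral_kernel_op_stationary_law)
  finally show "emeasure (stationary_law \<bind> K) A = emeasure stationary_law A" .
qed

text \<open>Invariance lets the mass of \<open>{a}\<close> be computed after one step, where every
  state has sent at least q to \<open>a\<close>.\<close>

lemma emeasure_stationary_law_reset: "emeasure stationary_law {a} > 0"
proof -
  have "0 < ennreal q * indicator {a} a" using q by simp
  also have "\<dots> = (\<integral>\<^sup>+x. ennreal q * indicator {a} a \<partial>stationary_law)"
    using stationary_law_in_space by (simp add: space_prob_algebra prob_space.emeasure_space_1 flip: space_stationary_law)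
  also have "\<dots> \<le> (\<integral>\<^sup>+x. kernel_op K (indicator {a}) x \<partial>stationary_law)"
    using a by (intro nn_integral_mono) (simp add: kernel_op_K)
  also have "\<dots> = emeasure stationary_law {a}"
    using a by (simp add: nn_integral_kernel_op_stationary_law)
  finally show ?thesis .
qed

section \<open>Recurrence, maximality and aperiodicity\<close>

lemma stationary_law_recurrent:
  assumes A: "A \<in> sets S" "emeasure stationary_law A > 0" and x: "x \<in> space S"
  shows "AE \<omega> in path_law S K x. \<exists>\<^sub>\<infinity>n. \<omega> n \<in> A"
proof -
  have ind: "indicator A \<in> borel_measurable S" using A by simp
  obtain n where n: "emeasure (walk n) A > 0"
  proof (rule ccontr)
    assume "\<not> thesis"
    then have "emeasure (walk n) A = 0" for n using that by (auto simp: zero_less_iff_neq_zero)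
    then show False using nn_integral_stationary_law[OF ind] A by simp
  qed
  \<comment> \<open>The factor q pays for a reset in the first step, and (1 - q)^n for n further
    steps without one. The bound is independent of the start, with lag \<open>Suc n\<close>.\<close>
  define e where "e = q * ((1 - q) ^ n * measure (walk n) A)"
  interpret walk: prob_space "walk n" using walk_in_space by (simp add: space_prob_algebra)
  have "0 < e" using n q by (simp add: e_def walk.emeasure_eq_measure)
  moreover have "ennreal e \<le> (kernel_op K ^^ Suc n) (indicator A) y" if "y \<in> space S" for y
  proof -
    have "ennreal e = ennreal q * (ennreal ((1 - q) ^ n) * (\<integral>\<^sup>+y. indicator A y \<partial>walk n))"
      using q A by (simp add: e_def walk.emeasure_eq_measure ennreal_mult)
    also have "\<dots> \<le> ennreal q * (kernel_op K ^^ n) (indicator A) a"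
      by (intro mult_left_mono walk_le_kernel_op[OF ind]) simp
    also have "\<dots> \<le> kernel_op K ((kernel_op K ^^ n) (indicator A)) y"
      by (simp add: kernel_op_K[OF that measurable_kernel_op_funpow[OF markov_kernel ind]])
    finally show ?thesis by simp
  qed
  ultimately show ?thesis
    by (rule AE_path_law_infinitely_often[OF markov_kernel x A(1)])
qed

text \<open>The atom is the test state: if the chain from \<open>a\<close> almost surely avoids
  \<open>A\<close>, an irreducibility measure must give \<open>A\<close> mass zero.\<close>

lemma irreducibility_measure_absolutely_continuous:
  assumes "irreducibility_measure S K \<phi>"
  shows "absolutely_continuous stationary_law \<phi>"
  unfolding absolutely_continuous_def
proof
  fix A assume "A \<in> null_sets stationary_law"
  then have A: "A \<in> sets S" "emeasure stationary_law A = 0" by auto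
  have ind: "indicator A \<in> borel_measurable S" using A by simp
  have "(kernel_op K ^^ n) (indicator A) a = 0" for n
  proof -
    have m: "(kernel_op K ^^ n) (indicator A) \<in> borel_measurable S" for n
      by (rule measurable_kernel_op_funpow[OF markov_kernel ind])
    have "(\<integral>\<^sup>+y. (kernel_op K ^^ n) (indicator A) y \<partial>stationary_law) = 0"
      using A by (induction n) (simp_all add: nn_integral_kernel_op_stationary_law m)
    \<comment> \<open>The nonnegative function has integral zero and \<open>{a}\<close> has positive
      mass, so its value at \<open>a\<close> vanishes.\<close>
    moreover have "(kernel_op K ^^ n) (indicator A) a * emeasure stationary_law {a} =
      (\<integral>\<^sup>+y. (kernel_op K ^^ n) (indicator A) a * indicator {a} y \<partial>stationary_law)"
      using a by (simp add: nn_integral_cmult_indicator)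
    moreover have "\<dots> \<le> (\<integral>\<^sup>+y. (kernel_op K ^^ n) (indicator A) y \<partial>stationary_law)"
      by (intro nn_integral_mono) (auto simp: indicator_def)
    ultimately show ?thesis using emeasure_stationary_law_reset by auto
  qed
  from AE_path_law_avoids[OF markov_kernel a(1) A(1) this]
  have "emeasure (path_law S K a) {\<omega> \<in> space (path_law S K a). \<exists>n\<ge>1. \<omega> n \<in> A} = 0"
    by (intro emeasure_eq_0_AE) auto
  then show "A \<in> null_sets \<phi>"
    using assms A a by (fastforce simp: irreducibility_measure_def null_sets_def zero_less_iff_neq_zero)
qed

text \<open>Irreducibility comes out of recurrence: infinitely many visits include one at a time at
  least 1, almost surely.\<close>

lemma maximal_irreducibility_measure_stationary_law: "maximal_irreducibility_measure S K stationary_law"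
proof -
  interpret prob_space stationary_law
    using stationary_law_in_space by (simp add: space_prob_algebra)
  have "emeasure (path_law S K x) {\<omega> \<in> space (path_law S K x). \<exists>n\<ge>1. \<omega> n \<in> A} > 0"
    if x: "x \<in> space S" and A: "A \<in> sets S" "emeasure stationary_law A > 0" for x A
  proof -
    interpret P: prob_space "path_law S K x" by (rule prob_space_path_law[OF markov_kernel x])
    note [measurable] = measurable_path_law_component[OF markov_kernel x] A(1)
    have "AE \<omega> in path_law S K x. \<exists>n\<ge>1. \<omega> n \<in> A"
      using stationary_law_recurrent[OF A x] by eventually_elim (auto simp: INFM_nat_le)
    then have "P.prob {\<omega> \<in> space (path_law S K x). \<exists>n\<ge>1. \<omega> n \<in> A} = 1"
      by (subst P.prob_Collect_eq_1) auto
    then show ?thesis by (simp add: P.emeasure_eq_measure)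
  qed
  then show ?thesis
    using irreducibility_measure_absolutely_continuous sigma_finite_measure_axioms emeasure_space_1
    by (simp add: maximal_irreducibility_measure_def irreducibility_measure_def)
qed

text \<open>The atom lies in some class because it has positive stationary mass. It returns to
  itself in one step with positive probability, so it lies in the next class too, and disjointness
  identifies the two.\<close>

lemma cycle_length_1:
  assumes "is_cycle S K stationary_law d D"
  shows "d = 1"
proof -
  have d: "d \<ge> 1" and D: "\<And>i. i < d \<Longrightarrow> D i \<in> sets S" and disj: "disjoint_family_on D {..<d}"
    and next_D: "\<And>i x. i < d \<Longrightarrow> x \<in> D i \<Longrightarrow> emeasure (K x) (D (Suc i mod d)) = 1"
    and null: "emeasure stationary_law (space S - (\<Union>i<d. D i)) = 0"
    using assms by (auto simp: is_cycle_def)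
  have "a \<in> (\<Union>i<d. D i)"
  proof (rule ccontr)
    assume "a \<notin> (\<Union>i<d. D i)"
    then have "emeasure stationary_law {a} \<le> emeasure stationary_law (space S - (\<Union>i<d. D i))"
      using a D by (intro emeasure_mono) auto
    with null emeasure_stationary_law_reset show False by simp
  qed
  then obtain i where i: "i < d" "a \<in> D i" by auto
  let ?j = "Suc i mod d"
  have j: "?j < d" using d by simp
  have "a \<in> D ?j"
  proof (rule ccontr)
    assume nj: "a \<notin> D ?j"
    interpret Ka: prob_space "K a"
      using measurable_space[OF K_measurable a(1)] by (simp add: space_prob_algebra)
    have sK: "sets (K a) = sets S"
      using measurable_space[OF K_measurable a(1)] by (simp add: space_prob_algebra)
    have "0 < kernel_op K (indicator {a}) a"
      using q a by (simp add: kernel_op_K zero_less_iff_neq_zero)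
    also have "\<dots> = emeasure (K a) {a}" using a sK by (simp add: kernel_op_def)
    finally have "0 < Ka.prob {a}" by (simp add: Ka.emeasure_eq_measure)
    moreover have "Ka.prob {a} + Ka.prob (D ?j) \<le> 1"
      using nj a D[OF j] sK by (subst Ka.finite_measure_Union[symmetric]) auto
    ultimately show False
      using next_D[OF i] by (simp add: Ka.emeasure_eq_measure)
  qed
  with i j disj have "?j = i"
    unfolding disjoint_family_on_def by (metis IntI emptyE lessThan_iff)
  \<comment> \<open>If \<open>Suc i < d\<close>, the modulus would leave \<open>Suc i\<close>,
    different from \<open>i\<close>; so \<open>Suc i = d\<close>, the next index is 0, and
    \<open>i = 0\<close>.\<close>
  then show ?thesis using i(1) d by (cases "Suc i = d") auto
qed

lemma harris_ergodic: "harris_ergodic S K"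
  unfolding harris_ergodic_def positive_harris_recurrent_def harris_recurrent_def aperiodic_def
  using markov_kernel maximal_irreducibility_measure_stationary_law stationary_law_recurrent
    stationary_law_in_space stationary_law_invariant cycle_length_1
  by blast

end

section \<open>The queue\<close>

lemma (in prob_space) markov_kernel_distr:
  assumes f: "case_prod f \<in> measurable (S \<Otimes>\<^sub>M M) S"
  shows "markov_kernel S (\<lambda>x. distr M S (f x))"
  unfolding markov_kernel_def
  using f by (intro measurable_distr_prob_space2[where M=M]) (auto simp: space_prob_algebra prob_space_axioms)

text \<open>Conditioning on the value of \<open>Z\<close>: the product is 0 on \<open>Z = 0\<close>,
  and on \<open>Z = 1\<close> independence leaves the law of \<open>X\<close> unchanged.\<close>

lemma (in prob_space) resetting_chain_reset_kernel:
  assumes q: "0 < q" "q < 1"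
    and indep: "indep_var borel X borel Z"
    and Z_values: "\<And>\<omega>. \<omega> \<in> space M \<Longrightarrow> Z \<omega> \<in> {0, 1}"
    and Z_0: "prob {\<omega> \<in> space M. Z \<omega> = 0} = q"
  shows "resetting_chain nonneg_reals (reset_kernel M X Z)
    (\<lambda>x. distr M nonneg_reals (\<lambda>\<omega>. max 0 (x + X \<omega>))) 0 q"
proof
  have X [measurable]: "random_variable borel X" and Z [measurable]: "random_variable borel Z"
    using indep by (auto dest: indep_var_rv1 indep_var_rv2)
  have id: "(\<lambda>x. x) \<in> borel_measurable nonneg_reals"
    by (rule measurable_restrict_space1) simp
  show "markov_kernel nonneg_reals (\<lambda>x. distr M nonneg_reals (\<lambda>\<omega>. max 0 (x + X \<omega>)))"
    by (intro markov_kernel_distr measurable_restrict_space2)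
      (auto simp: split_beta' intro!: borel_measurable_max borel_measurable_add
        measurable_compose[OF measurable_fst id])
  show "0 \<in> space nonneg_reals" "{0} \<in> sets nonneg_reals"
    by (auto simp: sets_restrict_space_iff)
  show "0 < q" "q < 1" by fact+
  fix x assume "x \<in> space nonneg_reals"
  let ?L = "distr M nonneg_reals (\<lambda>\<omega>. max 0 (x + X \<omega>))"
  let ?B = "\<lambda>b. if b then return nonneg_reals 0 else ?L"
  have Lm: "(\<lambda>\<omega>. max 0 (x + X \<omega>)) \<in> measurable M nonneg_reals"
    by (rule measurable_restrict_space2) auto
  have Km: "(\<lambda>\<omega>. Z \<omega> * max 0 (x + X \<omega>)) \<in> measurable M nonneg_reals"
    using Z_values by (intro measurable_restrict_space2) fastforce+
  have "return nonneg_reals (0::real) \<in> space (prob_algebra nonneg_reals)" "?L \<in> space (prob_algebra nonneg_reals)"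
    using prob_space_distr[OF Lm] by (auto simp: space_prob_algebra prob_space_return)
  then have B: "?B \<in> measurable (measure_pmf (bernoulli_pmf q)) (subprob_algebra nonneg_reals)"
    by (intro measurable_prob_algebraD) (auto simp: measurable_def space_prob_algebra)
  show "reset_kernel M X Z x = measure_pmf (bernoulli_pmf q) \<bind> ?B"
  proof (rule measure_eqI)
    show "sets (reset_kernel M X Z x) = sets (measure_pmf (bernoulli_pmf q) \<bind> ?B)"
      using sets_bind_measurable[OF B] by (simp add: reset_kernel_def)
    fix A assume "A \<in> sets (reset_kernel M X Z x)"
    then have A: "A \<in> sets nonneg_reals" by (simp add: reset_kernel_def)
    then have A' [measurable]: "A \<in> sets borel" by (simp add: sets_restrict_space_iff)
    have Z_1: "prob {\<omega> \<in> space M. Z \<omega> \<in> {1}} = 1 - q"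
    proof -
      have "{\<omega> \<in> space M. Z \<omega> \<in> {1}} = space M - {\<omega> \<in> space M. Z \<omega> = 0}"
        using Z_values by auto
      then show ?thesis using Z_0 by (simp add: prob_compl)
    qed
    have "{y. max 0 (x + y) \<in> A} \<in> sets borel" by measurable
    then have step: "prob {\<omega> \<in> space M. X \<omega> \<in> {y. max 0 (x + y) \<in> A} \<and> Z \<omega> \<in> {1}}
        = prob {\<omega> \<in> space M. max 0 (x + X \<omega>) \<in> A} * (1 - q)"
      using Z_1 by (subst prob_indep_random_variable[OF indep]) auto
    have "measure (reset_kernel M X Z x) A = prob {\<omega> \<in> space M. Z \<omega> * max 0 (x + X \<omega>) \<in> A}"
      using A by (simp add: reset_kernel_def measure_distr[OF Km] vimage_def Int_def conj_commute)
    \<comment> \<open>On the first piece the new state is 0 regardless of \<open>X\<close>, so only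
      the membership of 0 in \<open>A\<close> matters.\<close>
    also have "{\<omega> \<in> space M. Z \<omega> * max 0 (x + X \<omega>) \<in> A} =
        {\<omega> \<in> space M. Z \<omega> = 0 \<and> 0 \<in> A} \<union> {\<omega> \<in> space M. X \<omega> \<in> {y. max 0 (x + y) \<in> A} \<and> Z \<omega> \<in> {1}}"
      using Z_values by fastforce
    also have "prob \<dots> = prob {\<omega> \<in> space M. Z \<omega> = 0 \<and> 0 \<in> A} +
        prob {\<omega> \<in> space M. X \<omega> \<in> {y. max 0 (x + y) \<in> A} \<and> Z \<omega> \<in> {1}}"
      by (rule finite_measure_Union) auto
    also have "\<dots> = q * indicator A 0 + measure ?L A * (1 - q)"
      unfolding step using A Z_0
      by (simp add: measure_distr[OF Lm] vimage_def Int_def conj_commute split: split_indicator)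
    finally have "emeasure (reset_kernel M X Z x) A =
        ennreal q * indicator A 0 + ennreal (1 - q) * emeasure ?L A"
      using q prob_space_distr[OF Km] prob_space_distr[OF Lm]
      by (simp add: reset_kernel_def finite_measure.emeasure_eq_measure prob_space.finite_measure
          ennreal_mult ennreal_plus mult.commute split: split_indicator)
    also have "\<dots> = emeasure (measure_pmf (bernoulli_pmf q) \<bind> ?B) A"
      using q A by (subst emeasure_bind[OF _ B]) (simp_all add: mult.commute)
    finally show "emeasure (reset_kernel M X Z x) A = emeasure (measure_pmf (bernoulli_pmf q) \<bind> ?B) A" .
  qed
qed

text \<open>Both sides are the same mixture, determined by q and the law of the increment. This
  makes the chain time-homogeneous although step n uses its own pair of variables.\<close>

lemma (in prob_space) reset_kernel_cong:
  assumes q: "0 < q" "q < 1"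
    and indep: "indep_var borel X borel Z" "indep_var borel X' borel Z'"
    and Z_values: "\<And>\<omega>. \<omega> \<in> space M \<Longrightarrow> Z \<omega> \<in> {0, 1}" "\<And>\<omega>. \<omega> \<in> space M \<Longrightarrow> Z' \<omega> \<in> {0, 1}"
    and Z_0: "prob {\<omega> \<in> space M. Z \<omega> = 0} = q" "prob {\<omega> \<in> space M. Z' \<omega> = 0} = q"
    and X: "distr M borel X = distr M borel X'"
    and x: "x \<in> space nonneg_reals"
  shows "reset_kernel M X Z x = reset_kernel M X' Z' x"
proof -
  have m: "(\<lambda>y. max 0 (x + y)) \<in> measurable borel nonneg_reals"
    by (rule measurable_restrict_space2) auto
  have rv: "random_variable borel X" "random_variable borel X'"
    using indep by (auto dest: indep_var_rv1)
  have "distr M nonneg_reals (\<lambda>\<omega>. max 0 (x + X \<omega>)) = distr M nonneg_reals (\<lambda>\<omega>. max 0 (x + X' \<omega>))"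
    using distr_distr[OF m rv(1)] distr_distr[OF m rv(2)] X by (simp add: comp_def)
  then show ?thesis
    using resetting_chain.K_eq[OF resetting_chain_reset_kernel[OF q indep(1) Z_values(1) Z_0(1)] x]
      resetting_chain.K_eq[OF resetting_chain_reset_kernel[OF q indep(2) Z_values(2) Z_0(2)] x]
    by (simp only:)
qed

text \<open>Freezing of one independent variable: the joint law is a product, and Tonelli applies.
  Below, \<open>U\<close> carries the past and \<open>V\<close> the fresh randomness.\<close>

lemma (in prob_space) nn_integral_indep_var:
  assumes indep: "indep_var S U T V" and F: "F \<in> borel_measurable (S \<Otimes>\<^sub>M T)"
  shows "(\<integral>\<^sup>+\<omega>. F (U \<omega>, V \<omega>) \<partial>M) = (\<integral>\<^sup>+\<omega>. \<integral>\<^sup>+\<omega>'. F (U \<omega>, V \<omega>') \<partial>M \<partial>M)"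
proof -
  have U [measurable]: "random_variable S U" and V [measurable]: "random_variable T V"
    and prod: "distr M S U \<Otimes>\<^sub>M distr M T V = distr M (S \<Otimes>\<^sub>M T) (\<lambda>\<omega>. (U \<omega>, V \<omega>))"
    using indep by (auto simp: indep_var_distribution_eq)
  interpret V: prob_space "distr M T V" by (rule prob_space_distr) fact
  have F' [measurable]: "F \<in> borel_measurable (distr M S U \<Otimes>\<^sub>M distr M T V)"
    using F by (simp cong: measurable_cong_sets sets_pair_measure_cong)
  have "(\<integral>\<^sup>+\<omega>. F (U \<omega>, V \<omega>) \<partial>M) = (\<integral>\<^sup>+p. F p \<partial>(distr M S U \<Otimes>\<^sub>M distr M T V))"
    unfolding prod using F by (subst nn_integral_distr) auto
  also have "\<dots> = (\<integral>\<^sup>+u. \<integral>\<^sup>+v. F (u, v) \<partial>distr M T V \<partial>distr M S U)"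
    by (rule V.nn_integral_fst[symmetric, OF F'])
  also have "\<dots> = (\<integral>\<^sup>+\<omega>. \<integral>\<^sup>+v. F (U \<omega>, v) \<partial>distr M T V \<partial>M)"
    using V.borel_measurable_nn_integral_fst[OF F'] by (subst nn_integral_distr) auto
  also have "\<dots> = (\<integral>\<^sup>+\<omega>. \<integral>\<^sup>+\<omega>'. F (U \<omega>, V \<omega>') \<partial>M \<partial>M)"
  proof (intro nn_integral_cong nn_integral_distr V)
    fix \<omega> assume "\<omega> \<in> space M"
    then have "U \<omega> \<in> space (distr M S U)" using measurable_space[OF U] by simp
    then show "(\<lambda>v. F (U \<omega>, v)) \<in> borel_measurable (distr M T V)"
      using F' by (rule measurable_Pair1'[THEN measurable_compose])
  qed
  finally show ?thesis .
qed

section \<open>Merging the initial value and the two sequences into one independent family\<close>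

lemma (in prob_space) indep_vars_prob_Ball:
  assumes "indep_vars M' X I" "finite J" "J \<subseteq> I" "\<And>n. n \<in> J \<Longrightarrow> B n \<in> sets (M' n)"
  shows "prob {\<omega> \<in> space M. \<forall>n\<in>J. X n \<omega> \<in> B n} = (\<Prod>n\<in>J. prob (X n -` B n \<inter> space M))"
\<comment> \<open>\<open>indep_varsD\<close> asks for a nonempty index set. The empty case is wanted
  as well, since a finite set of indices may miss one of the sequences.\<close>
proof (cases "J = {}")
  case False
  then have "{\<omega> \<in> space M. \<forall>n\<in>J. X n \<omega> \<in> B n} = (\<Inter>n\<in>J. X n -` B n \<inter> space M)" by auto
  then show ?thesis using indep_varsD[OF assms(1) False assms(2,3)] assms(4) by simp
qed (simp add: prob_space)

text \<open>The initial value takes the index \<open>Inr 0\<close>, which \<open>Z\<close> leaves free.\<close>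

lemma (in prob_space) indep_vars_initial_sequences:
  assumes X: "indep_vars (\<lambda>_. borel) X UNIV" and Z: "indep_vars (\<lambda>_. borel) Z {1..}"
    and W0: "random_variable borel W0"
    and indep: "indep_initial_sequences M W0 X Z"
  shows "indep_vars (\<lambda>_. borel) (case_sum X (Z(0 := W0))) UNIV"
  unfolding indep_vars_def2
proof (intro conjI ballI indep_setsI)
  let ?Y = "case_sum X (Z(0 := W0))"
  have rvX: "random_variable borel (X n)" for n using X by (simp add: indep_vars_def2)
  have rvZ: "random_variable borel (Z n)" if "n \<noteq> 0" for n using Z that by (simp add: indep_vars_def2)
  show rv: "random_variable borel (?Y i)" for i
    using rvX rvZ W0 by (auto split: sum.split)
  show "{?Y i -` A \<inter> space M |A. A \<in> sets borel} \<subseteq> events" for i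
    using measurable_sets[OF rv] by blast
  fix A J assume J: "J \<noteq> {}" "finite J" and "\<forall>j\<in>J. A j \<in> {?Y j -` B \<inter> space M |B. B \<in> sets borel}"
  then have "\<forall>j\<in>J. \<exists>B. A j = ?Y j -` B \<inter> space M \<and> B \<in> sets borel" by auto
  then obtain B where B: "\<And>j. j \<in> J \<Longrightarrow> A j = ?Y j -` B j \<inter> space M" "\<And>j. j \<in> J \<Longrightarrow> B j \<in> sets borel"
    by metis
  define JX JR where "JX = Inl -` J" and "JR = Inr -` J"
  have J_eq: "J = JX <+> JR" by (auto simp: JX_def JR_def Plus_def) (metis sum.exhaust rangeI image_eqI vimageI)
  have fin: "finite JX" "finite JR" using J by (auto simp: JX_def JR_def finite_vimageI)
  have A_Inl: "A (Inl n) = X n -` B (Inl n) \<inter> space M" if "n \<in> JX" for n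
    using B(1)[of "Inl n"] that by (simp add: JX_def)
  have A_Inr: "A (Inr n) = (Z(0 := W0)) n -` B (Inr n) \<inter> space M" if "n \<in> JR" for n
    using B(1)[of "Inr n"] that by (simp add: JR_def)
  \<comment> \<open>Quantifying over \<open>JR \<inter> {0}\<close> makes this the whole space when
    the initial value is not among the chosen indices.\<close>
  define GW where "GW = {\<omega> \<in> space M. \<forall>n\<in>JR \<inter> {0}. W0 \<omega> \<in> B (Inr n)}"
  define GX where "GX = {\<omega> \<in> space M. \<forall>n\<in>JX. X n \<omega> \<in> B (Inl n)}"
  define GZ where "GZ = {\<omega> \<in> space M. \<forall>n\<in>JR - {0}. Z n \<omega> \<in> B (Inr n)}"
  have "(\<Inter>j\<in>J. A j) = GW \<inter> GX \<inter> GZ"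
  proof -
    have "\<omega> \<in> (\<Inter>j\<in>J. A j) \<longleftrightarrow> \<omega> \<in> GW \<inter> GX \<inter> GZ" for \<omega>
    proof -
      have "\<omega> \<in> (\<Inter>j\<in>J. A j) \<longleftrightarrow> \<omega> \<in> space M \<and> (\<forall>j\<in>J. ?Y j \<omega> \<in> B j)"
        using B(1) J(1) by auto
      also have "\<dots> \<longleftrightarrow> \<omega> \<in> GW \<inter> GX \<inter> GZ"
        unfolding J_eq Plus_def ball_Un by (auto simp: GW_def GX_def GZ_def split: if_splits)
      finally show ?thesis .
    qed
    then show ?thesis by blast
  qed
  \<comment> \<open>Independence between the three sigma-algebras splits off one event for each;
    independence within \<open>X\<close> and within \<open>Z\<close> then splits these
    further.\<close>
  also have "prob \<dots> = prob GW * prob GX * prob GZ"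
  proof -
    let ?F = "[vimage_algebra (space M) W0 borel,
           vimage_algebra (space M) (\<lambda>\<omega> n. X n \<omega>) (PiM UNIV (\<lambda>_. borel)),
           vimage_algebra (space M) (\<lambda>\<omega>. \<lambda>n\<in>{1..}. Z n \<omega>) (PiM {1..} (\<lambda>_. borel))]"
    let ?E = "[GW, GX, GZ]"
    have "GW = W0 -` {y. \<forall>n\<in>JR \<inter> {0}. y \<in> B (Inr n)} \<inter> space M" by (auto simp: GW_def)
    moreover have "{y. \<forall>n\<in>JR \<inter> {0}. y \<in> B (Inr n)} \<in> sets borel"
      using B(2) by (cases "0 \<in> JR") (auto simp: J_eq)
    ultimately have GW: "GW \<in> sets (?F ! 0)" by (simp only: nth_Cons_0 in_vimage_algebra)
    have mX: "{f \<in> space (PiM UNIV (\<lambda>_. borel)). \<forall>n\<in>JX. f n \<in> B (Inl n)} \<in> sets (PiM UNIV (\<lambda>_. borel :: real measure))"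
      using B(2) fin by (intro sets.sets_Collect_finite_All sets_Collect_single) (auto simp: J_eq)
    have "GX = (\<lambda>\<omega> n. X n \<omega>) -` {f \<in> space (PiM UNIV (\<lambda>_. borel)). \<forall>n\<in>JX. f n \<in> B (Inl n)} \<inter> space M"
      by (auto simp: GX_def space_PiM)
    then have GX: "GX \<in> sets (?F ! 1)" using in_vimage_algebra[OF mX] by simp
    have mZ: "{f \<in> space (PiM {1..} (\<lambda>_. borel)). \<forall>n\<in>JR - {0}. f n \<in> B (Inr n)} \<in> sets (PiM {1..} (\<lambda>_. borel :: real measure))"
      using B(2) fin by (intro sets.sets_Collect_finite_All sets_Collect_single) (auto simp: J_eq)
    have "GZ = (\<lambda>\<omega>. \<lambda>n\<in>{1..}. Z n \<omega>) -` {f \<in> space (PiM {1..} (\<lambda>_. borel)). \<forall>n\<in>JR - {0}. f n \<in> B (Inr n)} \<inter> space M"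
      by (auto simp: GZ_def space_PiM)
    then have "GZ \<in> sets (vimage_algebra (space M) (\<lambda>\<omega>. \<lambda>n\<in>{1..}. Z n \<omega>) (PiM {1..} (\<lambda>_. borel)))"
      by (simp only: in_vimage_algebra[OF mZ])
    then have GZ: "GZ \<in> sets (?F ! 2)" by simp
    have "\<forall>i\<in>{..<3}. ?E ! i \<in> sets (?F ! i)"
      using GW GX GZ by (auto simp: less_Suc_eq numeral_3_eq_3 numeral_2_eq_2)
    with indep have "prob (\<Inter>i\<in>{..<3}. ?E ! i) = (\<Prod>i\<in>{..<3}. prob (?E ! i))"
      unfolding indep_initial_sequences_def by (intro indep_setsD) (auto simp: lessThan_empty_iff)
    then show ?thesis
      by (simp add: numeral_3_eq_3 lessThan_Suc Int_ac mult_ac)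
  qed
  also have "prob GW = (\<Prod>n\<in>JR \<inter> {0}. prob (A (Inr n)))"
    by (cases "0 \<in> JR") (auto simp: GW_def A_Inr prob_space intro!: arg_cong[where f=prob])
  also have "prob GX = (\<Prod>n\<in>JX. prob (A (Inl n)))"
    unfolding GX_def using fin B(2) by (subst indep_vars_prob_Ball[OF X]) (auto simp: A_Inl J_eq)
  also have "prob GZ = (\<Prod>n\<in>JR - {0}. prob (A (Inr n)))"
    unfolding GZ_def using fin B(2) by (subst indep_vars_prob_Ball[OF Z]) (auto simp: A_Inr J_eq)
  also have "(\<Prod>n\<in>JR \<inter> {0}. prob (A (Inr n))) * (\<Prod>n\<in>JX. prob (A (Inl n))) * (\<Prod>n\<in>JR - {0}. prob (A (Inr n)))
      = (\<Prod>j\<in>J. prob (A j))"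
    using fin by (simp add: J_eq prod.Plus prod.Int_Diff[of JR _ "{0}"] comp_def mult_ac)
  finally show "prob (\<Inter>j\<in>J. A j) = (\<Prod>j\<in>J. prob (A j))" .
qed


text \<open>The outer \<open>max\<close> does not change the states that occur; it keeps the value in the state space for
  every argument \<open>u\<close>.\<close>

primrec queue_state :: "(nat + nat \<Rightarrow> real) \<Rightarrow> nat \<Rightarrow> real" where
  "queue_state u 0 = max 0 (u (Inr 0))"
| "queue_state u (Suc n) = max 0 (u (Inr (Suc n)) * max 0 (queue_state u n + u (Inl n)))"

text \<open>The state at time n reads X_0, ..., X_{n-1}, the initial value and Z_1, ..., Z_n. A
  larger \<open>I\<close> is allowed so that all states up to a given time live on one product
  space.\<close>

lemma measurable_queue_state:
  assumes "Inl ` {..<n} \<union> Inr ` {..n} \<subseteq> I"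
  shows "(\<lambda>u. queue_state u n) \<in> borel_measurable (PiM I (\<lambda>_. borel))"
  using assms
proof (induction n)
  case 0
  then have [measurable]: "(\<lambda>u. u (Inr 0)) \<in> borel_measurable (PiM I (\<lambda>_. borel))"
    by (intro measurable_component_singleton) auto
  show ?case unfolding queue_state.simps by measurable
next
  case (Suc n)
  have [measurable]: "(\<lambda>u. queue_state u n) \<in> borel_measurable (PiM I (\<lambda>_. borel))"
    using Suc.prems by (intro Suc.IH) auto
  have [measurable]: "(\<lambda>u. u (Inr (Suc n))) \<in> borel_measurable (PiM I (\<lambda>_. borel))"
    "(\<lambda>u. u (Inl n)) \<in> borel_measurable (PiM I (\<lambda>_. borel))"
    using Suc.prems by (auto intro!: measurable_component_singleton)
  show ?case unfolding queue_state.simps by measurable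
qed

lemma queue_state_nonneg: "queue_state u n \<ge> 0"
  by (cases n) auto

lemma queue_state_restrict:
  assumes "Inl ` {..<n} \<union> Inr ` {..n} \<subseteq> I"
  shows "queue_state (restrict u I) n = queue_state u n"
  using assms
proof (induction n)
  case (Suc n)
  have "queue_state (restrict u I) n = queue_state u n"
    using Suc.prems by (intro Suc.IH) auto
  moreover have "Inr (Suc n) \<in> I" "Inl n \<in> I" using Suc.prems by auto
  ultimately show ?case by (simp add: restrict_apply' del: restrict_apply)
qed auto

text \<open>A conditional expectation is determined by its integrals over the sets of the history.
  Nonnegative integrals are used in the premise because Tonelli delivers them directly.\<close>

lemma markov_chainI:
  assumes M: "prob_space M" and K: "markov_kernel S K" and W: "\<And>n. W n \<in> measurable M S"
    and step: "\<And>n A B. A \<in> sets S \<Longrightarrow> B \<in> sets (PiM {..n} (\<lambda>_. S)) \<Longrightarrow>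
      (\<integral>\<^sup>+\<omega>. indicator B (\<lambda>i\<in>{..n}. W i \<omega>) * indicator A (W (Suc n) \<omega>) \<partial>M) =
      (\<integral>\<^sup>+\<omega>. indicator B (\<lambda>i\<in>{..n}. W i \<omega>) * emeasure (K (W n \<omega>)) A \<partial>M)"
  shows "markov_chain M S K W"
  unfolding markov_chain_def
proof (intro conjI allI ballI K W)
  interpret prob_space M by fact
  fix n A assume A [measurable]: "A \<in> sets S"
  have Km [measurable]: "K \<in> measurable S (prob_algebra S)"
    using K by (simp add: markov_kernel_def)
  note W [measurable]
  let ?h = "\<lambda>\<omega>. \<lambda>i\<in>{..n}. W i \<omega>"
  have h [measurable]: "?h \<in> measurable M (PiM {..n} (\<lambda>_. S))"
    by (intro measurable_restrict W)
  have h_space: "?h \<in> space M \<rightarrow> space (PiM {..n} (\<lambda>_. S))"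
    using measurable_space[OF h] by auto
  \<comment> \<open>Every event of the history is the preimage of a set \<open>B\<close> of finite
    histories, so testing against all \<open>B\<close> suffices.\<close>
  have sets_history: "sets (history M S W n) = {?h -` B \<inter> space M |B. B \<in> sets (PiM {..n} (\<lambda>_. S))}"
    unfolding history_def by (rule sets_vimage_algebra2[OF h_space])
  have sub: "subalgebra M (history M S W n)"
    using measurable_sets[OF h] by (auto simp: subalgebra_def sets_history) (simp_all add: history_def)
  interpret finite_measure_subalgebra M "history M S W n"
    using sub by unfold_locales
  have K_prob: "prob_space (K (W n \<omega>))" if "\<omega> \<in> space M" for \<omega>
    using measurable_space[OF Km measurable_space[OF W that]] by (simp add: space_prob_algebra)
  have g: "(\<lambda>y. measure (K y) A) \<in> borel_measurable S" by measurable
  have g_bound: "\<bar>measure (K (W n \<omega>)) A\<bar> \<le> 1" if "\<omega> \<in> space M" for \<omega>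
    using prob_space.prob_le_1[OF K_prob[OF that]] by simp
  show "AE \<omega> in M. real_cond_exp M (history M S W n) (\<lambda>\<omega>. indicator A (W (Suc n) \<omega>)) \<omega> = measure (K (W n \<omega>)) A"
  proof (rule real_cond_exp_charact)
    have "?h \<in> measurable (history M S W n) (PiM {..n} (\<lambda>_. S))"
      unfolding history_def by (rule measurable_vimage_algebra1[OF h_space])
    from measurable_compose[OF this measurable_component_singleton[of n]]
    have "W n \<in> measurable (history M S W n) S" by simp
    from measurable_compose[OF this g]
    show "(\<lambda>\<omega>. measure (K (W n \<omega>)) A) \<in> borel_measurable (history M S W n)" .
    show "integrable M (\<lambda>\<omega>. indicator A (W (Suc n) \<omega>) :: real)"
      by (rule integrable_const_bound[where B=1]) auto
    show "integrable M (\<lambda>\<omega>. measure (K (W n \<omega>)) A)"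
      using measurable_compose[OF W g] g_bound by (intro integrable_const_bound[where B=1]) auto
    fix H assume "H \<in> sets (history M S W n)"
    then obtain B where B [measurable]: "B \<in> sets (PiM {..n} (\<lambda>_. S))" and H: "H = ?h -` B \<inter> space M"
      by (auto simp: sets_history)
    have H_ind: "indicator H \<omega> = (indicator B (?h \<omega>) :: real)" if "\<omega> \<in> space M" for \<omega>
      using that by (auto simp: H indicator_def)
    have [measurable]: "(\<lambda>\<omega>. measure (K (W n \<omega>)) A) \<in> borel_measurable M"
      by (rule measurable_compose[OF W g])
    have "(\<integral>\<omega>\<in>H. (indicator A (W (Suc n) \<omega>) :: real) \<partial>M) = (\<integral>\<omega>. indicator B (?h \<omega>) * indicator A (W (Suc n) \<omega>) \<partial>M)"
      unfolding set_lebesgue_integral_def by (intro Bochner_Integration.integral_cong) (simp_all add: H_ind)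
    also have "\<dots> = enn2real (\<integral>\<^sup>+\<omega>. indicator B (?h \<omega>) * indicator A (W (Suc n) \<omega>) \<partial>M)"
      by (subst integral_eq_nn_integral) (auto simp: ennreal_mult ennreal_indicator)
    also have "\<dots> = enn2real (\<integral>\<^sup>+\<omega>. indicator B (?h \<omega>) * emeasure (K (W n \<omega>)) A \<partial>M)"
      by (simp only: step[OF A B])
    also have "(\<integral>\<^sup>+\<omega>. indicator B (?h \<omega>) * emeasure (K (W n \<omega>)) A \<partial>M) =
        (\<integral>\<^sup>+\<omega>. ennreal (indicator B (?h \<omega>) * measure (K (W n \<omega>)) A) \<partial>M)"
      using K_prob by (intro nn_integral_cong)
        (simp add: ennreal_mult ennreal_indicator finite_measure.emeasure_eq_measure prob_space.finite_measure)
    also have "enn2real \<dots> = (\<integral>\<omega>. indicator B (?h \<omega>) * measure (K (W n \<omega>)) A \<partial>M)"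
      by (subst integral_eq_nn_integral) auto
    also have "\<dots> = (\<integral>\<omega>\<in>H. measure (K (W n \<omega>)) A \<partial>M)"
      unfolding set_lebesgue_integral_def by (intro Bochner_Integration.integral_cong) (simp_all add: H_ind)
    finally show "(\<integral>\<omega>\<in>H. (indicator A (W (Suc n) \<omega>) :: real) \<partial>M) = (\<integral>\<omega>\<in>H. measure (K (W n \<omega>)) A \<partial>M)" .
  qed
qed

section \<open>The waiting times as a Markov chain\<close>

theorem proposition4p1:
  fixes M :: "'a measure" and q :: real
    and X Z W :: "nat \<Rightarrow> 'a \<Rightarrow> real"
  assumes M: "prob_space M"
    and q: "0 < q" "q < 1"
    and X_indep: "prob_space.indep_vars M (\<lambda>_. borel) X UNIV"
    and X_ident: "\<And>n. distr M borel (X n) = distr M borel (X 0)"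
    and Z_indep: "prob_space.indep_vars M (\<lambda>_. borel) Z {1..}"
    and Z_values: "\<And>n \<omega>. n \<ge> 1 \<Longrightarrow> \<omega> \<in> space M \<Longrightarrow> Z n \<omega> \<in> {0, 1}"
    and Z_0: "\<And>n. n \<ge> 1 \<Longrightarrow> measure M {\<omega> \<in> space M. Z n \<omega> = 0} = q"
    and Z_1: "\<And>n. n \<ge> 1 \<Longrightarrow> measure M {\<omega> \<in> space M. Z n \<omega> = 1} = 1 - q"
    and W_0_meas: "W 0 \<in> borel_measurable M"
    and W_0_nonneg: "\<And>\<omega>. \<omega> \<in> space M \<Longrightarrow> W 0 \<omega> \<ge> 0"
    and indep: "indep_initial_sequences M (W 0) X Z"
    and W_Suc: "\<And>n \<omega>. \<omega> \<in> space M \<Longrightarrow> W (Suc n) \<omega> = Z (Suc n) \<omega> * max 0 (W n \<omega> + X n \<omega>)"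
  shows "markov_chain M nonneg_reals (reset_kernel M (X 0) (Z 1)) W \<and>
         harris_ergodic nonneg_reals (reset_kernel M (X 0) (Z 1))"
proof -
  interpret prob_space M by fact
  define Y where "Y = case_sum X (Z(0 := W 0))"
  have Y_indep: "indep_vars (\<lambda>_. borel) Y UNIV"
    unfolding Y_def by (rule indep_vars_initial_sequences[OF X_indep Z_indep W_0_meas indep])
  have Y_rv [measurable]: "random_variable borel (Y i)" for i
    using Y_indep by (simp add: indep_vars_def2)
  have Y_Inl: "Y (Inl n) = X n" and Y_Inr: "Y (Inr (Suc n)) = Z (Suc n)" and Y_0: "Y (Inr 0) = W 0" for n
    by (simp_all add: Y_def)
  \<comment> \<open>Two disjoint singleton blocks of the merged family.\<close>
  have XZ: "indep_var borel (X n) borel (Z (Suc n))" for n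
  proof -
    have "indep_var borel ((\<lambda>u. u (Inl n)) \<circ> (\<lambda>\<omega>. restrict (\<lambda>i. Y i \<omega>) {Inl n}))
        borel ((\<lambda>u. u (Inr (Suc n))) \<circ> (\<lambda>\<omega>. restrict (\<lambda>i. Y i \<omega>) {Inr (Suc n)}))"
      by (rule indep_var_compose[OF indep_var_restrict[OF Y_indep]])
        (auto intro: measurable_component_singleton)
    then show ?thesis by (simp add: comp_def Y_Inl Y_Inr)
  qed
  let ?K = "reset_kernel M (X 0) (Z 1)"
  interpret chain: resetting_chain nonneg_reals ?K "\<lambda>x. distr M nonneg_reals (\<lambda>\<omega>. max 0 (x + X 0 \<omega>))" 0 q
    using Z_values Z_0 XZ[of 0] by (intro resetting_chain_reset_kernel[OF q]) auto
  \<comment> \<open>The kernel is built from \<open>X 0\<close> and \<open>Z 1\<close>, while step n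
    uses \<open>X n\<close> and \<open>Z (Suc n)\<close>; equal laws make the kernels agree.\<close>
  have K_eq: "reset_kernel M (X n) (Z (Suc n)) x = ?K x" if "x \<in> space nonneg_reals" for n x
    using Z_values Z_0 XZ[of n] XZ[of 0] X_ident[of n]
    by (intro reset_kernel_cong[OF q _ _ _ _ _ _ _ that]) auto
  have W_eq: "W n \<omega> = queue_state (\<lambda>i. Y i \<omega>) n" if "\<omega> \<in> space M" for n \<omega>
  proof (induction n)
    case 0
    then show ?case using W_0_nonneg[OF that] by (simp add: Y_0)
  next
    case (Suc n)
    then show ?case
      using W_Suc[OF that, of n] Z_values[OF _ that, of "Suc n"] by (auto simp: Y_Inl Y_Inr)
  qed
  have W_meas: "W n \<in> measurable M nonneg_reals" for n
  proof (rule measurable_restrict_space2)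
    show "W n \<in> space M \<rightarrow> {0..}" using queue_state_nonneg by (simp add: W_eq)
    show "W n \<in> borel_measurable M"
    proof (induction n)
      case (Suc n)
      then have "(\<lambda>\<omega>. Y (Inr (Suc n)) \<omega> * max 0 (W n \<omega> + Y (Inl n) \<omega>)) \<in> borel_measurable M"
        by measurable
      then show ?case
        by (rule measurable_cong[THEN iffD1, rotated]) (simp add: W_Suc Y_Inl Y_Inr)
    qed (rule W_0_meas)
  qed
  have "markov_chain M nonneg_reals ?K W"
  proof (rule markov_chainI[OF M chain.markov_kernel W_meas])
    fix n :: nat and A B
    assume A: "A \<in> sets nonneg_reals" and B [measurable]: "B \<in> sets (PiM {..n} (\<lambda>_. nonneg_reals))"
    have A' [measurable]: "A \<in> sets borel" using A by (simp add: sets_restrict_space_iff)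
    \<comment> \<open>\<open>I\<close> holds everything that determines W_0, ..., W_n, and
      \<open>J\<close> the variables entering only at the next step; they are disjoint.\<close>
    define I :: "(nat + nat) set" where "I = Inl ` {..<n} \<union> Inr ` {..n}"
    define J :: "(nat + nat) set" where "J = {Inl n, Inr (Suc n)}"
    let ?U = "\<lambda>\<omega>. restrict (\<lambda>i. Y i \<omega>) I" and ?V = "\<lambda>\<omega>. restrict (\<lambda>i. Y i \<omega>) J"
    have UV: "indep_var (PiM I (\<lambda>_. borel)) ?U (PiM J (\<lambda>_. borel)) ?V"
      by (rule indep_var_restrict[OF Y_indep]) (auto simp: I_def J_def)
    have Inc: "Inl ` {..<i} \<union> Inr ` {..i} \<subseteq> I" if "i \<le> n" for i using that by (auto simp: I_def)
    have state [measurable]: "(\<lambda>u. queue_state u i) \<in> borel_measurable (PiM I (\<lambda>_. borel))" if "i \<le> n" for i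
      by (rule measurable_queue_state[OF Inc[OF that]])
    have hist [measurable]: "(\<lambda>u. \<lambda>i\<in>{..n}. queue_state u i) \<in> measurable (PiM I (\<lambda>_. borel)) (PiM {..n} (\<lambda>_. nonneg_reals))"
      using queue_state_nonneg by (intro measurable_restrict measurable_restrict_space2) (auto intro: state)
    have [measurable]: "(\<lambda>v. v (Inl n)) \<in> borel_measurable (PiM J (\<lambda>_. borel :: real measure))"
      "(\<lambda>v. v (Inr (Suc n))) \<in> borel_measurable (PiM J (\<lambda>_. borel :: real measure))"
      by (auto simp: J_def intro!: measurable_component_singleton)
    \<comment> \<open>The past enters through \<open>u\<close> and the next step through
      \<open>v\<close>. Integrating \<open>F\<close> with \<open>u\<close> frozen produces the
      transition kernel at \<open>W n \<omega>\<close>.\<close>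
    define F :: "(nat + nat \<Rightarrow> real) \<times> (nat + nat \<Rightarrow> real) \<Rightarrow> ennreal" where
      "F = (\<lambda>(u, v). indicator B (\<lambda>i\<in>{..n}. queue_state u i) *
        indicator A (v (Inr (Suc n)) * max 0 (queue_state u n + v (Inl n))))"
    have F: "F \<in> borel_measurable (PiM I (\<lambda>_. borel) \<Otimes>\<^sub>M PiM J (\<lambda>_. borel))"
      unfolding F_def using state[of n] by measurable
    have F_eq: "F (?U \<omega>, ?V \<omega>') = indicator B (\<lambda>i\<in>{..n}. W i \<omega>) *
        indicator A (Z (Suc n) \<omega>' * max 0 (W n \<omega> + X n \<omega>'))" if "\<omega> \<in> space M" for \<omega> \<omega>'
    proof -
      have "(\<lambda>i\<in>{..n}. queue_state (?U \<omega>) i) = (\<lambda>i\<in>{..n}. W i \<omega>)"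
        using that Inc by (intro restrict_ext) (simp add: queue_state_restrict W_eq)
      moreover have "queue_state (?U \<omega>) n = W n \<omega>"
        using that Inc by (simp add: queue_state_restrict W_eq)
      ultimately show ?thesis by (simp add: F_def J_def Y_Inl Y_Inr)
    qed
    have "(\<integral>\<^sup>+\<omega>. indicator B (\<lambda>i\<in>{..n}. W i \<omega>) * indicator A (W (Suc n) \<omega>) \<partial>M) =
        (\<integral>\<^sup>+\<omega>. F (?U \<omega>, ?V \<omega>) \<partial>M)"
      by (intro nn_integral_cong) (simp only: F_eq W_Suc)
    also have "\<dots> = (\<integral>\<^sup>+\<omega>. \<integral>\<^sup>+\<omega>'. F (?U \<omega>, ?V \<omega>') \<partial>M \<partial>M)"
      by (rule nn_integral_indep_var[OF UV F])
    also have "\<dots> = (\<integral>\<^sup>+\<omega>. indicator B (\<lambda>i\<in>{..n}. W i \<omega>) * emeasure (?K (W n \<omega>)) A \<partial>M)"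
    proof (intro nn_integral_cong)
      fix \<omega> assume \<omega>: "\<omega> \<in> space M"
      have [measurable]: "random_variable borel (X n)" "random_variable borel (Z (Suc n))"
        using XZ by (auto dest: indep_var_rv1 indep_var_rv2)
      have m: "(\<lambda>\<omega>'. Z (Suc n) \<omega>' * max 0 (W n \<omega> + X n \<omega>')) \<in> measurable M nonneg_reals"
        using Z_values[of "Suc n"] by (intro measurable_restrict_space2) fastforce+
      have "(\<integral>\<^sup>+\<omega>'. F (?U \<omega>, ?V \<omega>') \<partial>M) = indicator B (\<lambda>i\<in>{..n}. W i \<omega>) *
          (\<integral>\<^sup>+\<omega>'. indicator A (Z (Suc n) \<omega>' * max 0 (W n \<omega> + X n \<omega>')) \<partial>M)"
        using \<omega> by (simp only: F_eq) (intro nn_integral_cmult, measurable)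
      also have "(\<integral>\<^sup>+\<omega>'. indicator A (Z (Suc n) \<omega>' * max 0 (W n \<omega> + X n \<omega>')) \<partial>M) =
          emeasure (reset_kernel M (X n) (Z (Suc n)) (W n \<omega>)) A"
        unfolding reset_kernel_def using A
        by (subst nn_integral_distr[OF m, symmetric]) (auto intro!: nn_integral_indicator)
      also have "reset_kernel M (X n) (Z (Suc n)) (W n \<omega>) = ?K (W n \<omega>)"
        by (rule K_eq[OF measurable_space[OF W_meas \<omega>]])
      finally show "(\<integral>\<^sup>+\<omega>'. F (?U \<omega>, ?V \<omega>') \<partial>M) =
        indicator B (\<lambda>i\<in>{..n}. W i \<omega>) * emeasure (?K (W n \<omega>)) A" .
    qed
    finally show "(\<integral>\<^sup>+\<omega>. indicator B (\<lambda>i\<in>{..n}. W i \<omega>) * indicator A (W (Suc n) \<omega>) \<partial>M) =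
        (\<integral>\<^sup>+\<omega>. indicator B (\<lambda>i\<in>{..n}. W i \<omega>) * emeasure (?K (W n \<omega>)) A \<partial>M)" .
  qed
  then show ?thesis using chain.harris_ergodic by simp
qed

end
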